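(* Each Hausdorff topological semilattice $X$ is $\omega$-Lawson.
   Context: A semilattice is a commutative semigroup all of whose elements are idempotents. A topological semilattice is a semilattice endowed with a topology for which the operation $X\times X\to X$, $(x,y)\mapsto xy$, is (jointly) continuous. A closed neighborhood of a point $x$ is a closed set containing $x$ in its interior. A semilattice $X$ endowed with a topology is $\omega$-Lawson if for any distinct points $x,y\in X$ there exists a countable family $\mathcal U$ of closed neighborhoods of $x$ such that $\bigcap\mathcal U$ is a subsemilattice of $X$ that does not contain $y$. *)

theory Defs
  imports "HOL-Analysis.Analysis"
begin

locale topological_semilattice = semilattice f
  for f :: "'a::topological_space \<Rightarrow> 'a \<Rightarrow> 'a" +
  assumes jointly_continuous: "continuous_on UNIV (\<lambda>(x, y). f x y)"

definition closed_neighborhood :: "'a::topological_space \<Rightarrow> 'a set \<Rightarrow> bool" where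
  "closed_neighborhood x N \<longleftrightarrow> closed N \<and> x \<in> interior N"

definition subsemilattice :: "('a \<Rightarrow> 'a \<Rightarrow> 'a) \<Rightarrow> 'a set \<Rightarrow> bool" where
  "subsemilattice f S \<longleftrightarrow> (\<forall>a\<in>S. \<forall>b\<in>S. f a b \<in> S)"

(* Continuity of the operation is deliberately not part of this notion. *)
locale omega_Lawson = semilattice f
  for f :: "'a::topological_space \<Rightarrow> 'a \<Rightarrow> 'a" +
  assumes separation: "\<And>x y. x \<noteq> y \<Longrightarrow>
    \<exists>\<U>. countable \<U> \<and> (\<forall>N\<in>\<U>. closed_neighborhood x N) \<and>
        subsemilattice f (\<Inter>\<U>) \<and> y \<notin> \<Inter>\<U>"

end

theory Submission
  imports Defs
begin

text \<open>
  Since \<^term>\<open>x\<close> is idempotent, joint continuity at the point \<^term>\<open>(x, x)\<close> gives, for every open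
  neighborhood of \<^term>\<open>x\<close>, another one whose pairwise products lie in the given one
  (\<open>open_idempotent_shrink\<close>). Iterating from an open neighborhood \<open>V 0\<close> whose closure misses
  \<^term>\<open>y\<close> yields open sets with \<open>V (Suc n) \<cdot> V (Suc n) \<subseteq> V n\<close>. A Hausdorff space need not be
  regular, so \<open>closure (V (Suc n)) \<subseteq> V n\<close> is not to be expected. Instead, joint continuity carries
  the product relation over to the closures (\<open>closure_prod_subset\<close>), and hence the intersection
  of the closures is closed under the operation: a product of two of its points lies in each
  \<open>closure (V n)\<close> because both factors lie in \<open>closure (V (Suc n))\<close>.
\<close>

lemma closure_prod_subset:
  fixes f :: "'a::topological_space \<Rightarrow> 'b::topological_space \<Rightarrow> 'c::topological_space"
  assumes cont: "continuous_on UNIV (\<lambda>(x, y). f x y)"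
    and prods: "\<And>a b. a \<in> A \<Longrightarrow> b \<in> B \<Longrightarrow> f a b \<in> C"
    and "a \<in> closure A" "b \<in> closure B"
  shows "f a b \<in> closure C"
proof -
  have "(\<lambda>(x, y). f x y) ` closure (A \<times> B) \<subseteq> closure C"
  proof (rule image_closure_subset)
    show "continuous_on (closure (A \<times> B)) (\<lambda>(x, y). f x y)"
      using cont continuous_on_subset by blast
    show "(\<lambda>(x, y). f x y) ` (A \<times> B) \<subseteq> closure C"
      using prods closure_subset by fastforce
  qed simp
  with assms(3,4) show ?thesis
    by (auto simp: closure_Times)
qed

lemma open_idempotent_shrink:
  fixes f :: "'a::topological_space \<Rightarrow> 'a \<Rightarrow> 'a"
  assumes cont: "continuous_on UNIV (\<lambda>(x, y). f x y)"
    and idem: "f x x = x" and "open V" "x \<in> V"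
  obtains W where "open W" "x \<in> W" "\<And>a b. a \<in> W \<Longrightarrow> b \<in> W \<Longrightarrow> f a b \<in> V"
proof -
  have "open ((\<lambda>(x, y). f x y) -` V)"
    using cont \<open>open V\<close> by (auto intro: open_vimage)
  moreover have "(x, x) \<in> (\<lambda>(x, y). f x y) -` V"
    using idem \<open>x \<in> V\<close> by simp
  ultimately obtain A B where AB: "open A" "open B" "x \<in> A" "x \<in> B"
      "A \<times> B \<subseteq> (\<lambda>(x, y). f x y) -` V"
    by (auto elim!: open_prod_elim)
  show thesis
    by (rule that[of "A \<inter> B"]) (use AB in auto)
qed

lemma t2_open_closure_avoids:
  fixes x y :: "'a::t2_space"
  assumes "x \<noteq> y"
  obtains V where "open V" "x \<in> V" "y \<notin> closure V"
proof -
  obtain V W where VW: "open V" "open W" "x \<in> V" "y \<in> W" "V \<inter> W = {}"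
    using hausdorff[OF assms] by blast
  then have "y \<notin> closure V"
    using open_Int_closure_eq_empty[of W V] by blast
  with VW that show thesis by blast
qed

theorem proposition3:
  fixes f :: "'a::t2_space \<Rightarrow> 'a \<Rightarrow> 'a"
  assumes "topological_semilattice f"
  shows "omega_Lawson f"
proof -
  interpret topological_semilattice f by fact
  show ?thesis
  proof
    fix x y :: 'a
    assume "x \<noteq> y"
    then obtain V0 where V0: "open V0" "x \<in> V0" "y \<notin> closure V0"
      by (rule t2_open_closure_avoids)
    have "\<exists>V. \<forall>n. (open (V n) \<and> x \<in> V n \<and> (n = 0 \<longrightarrow> V n = V0)) \<and>
        (\<forall>a\<in>V (Suc n). \<forall>b\<in>V (Suc n). f a b \<in> V n)"
    proof (rule dependent_nat_choice)
      fix U and n :: nat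
      assume "open U \<and> x \<in> U \<and> (n = 0 \<longrightarrow> U = V0)"
      then have "open U" "x \<in> U" by simp_all
      then obtain W where "open W" "x \<in> W" "\<And>a b. a \<in> W \<Longrightarrow> b \<in> W \<Longrightarrow> f a b \<in> U"
        using open_idempotent_shrink[OF jointly_continuous idem] by blast
      then show "\<exists>W. (open W \<and> x \<in> W \<and> (Suc n = 0 \<longrightarrow> W = V0)) \<and> (\<forall>a\<in>W. \<forall>b\<in>W. f a b \<in> U)"
        by blast
    qed (use V0 in blast)
    then obtain V where V: "\<And>n. open (V n)" "\<And>n. x \<in> V n" "V 0 = V0"
      and prods: "\<And>n a b. a \<in> V (Suc n) \<Longrightarrow> b \<in> V (Suc n) \<Longrightarrow> f a b \<in> V n"
      by blast
    let ?\<U> = "range (\<lambda>n. closure (V n))"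
    have "closed_neighborhood x (closure (V n))" for n
      using V(1,2)[of n] interior_maximal[OF closure_subset, of "V n"]
      unfolding closed_neighborhood_def by auto
    moreover have "subsemilattice f (\<Inter>?\<U>)"
    proof -
      have "f a b \<in> closure (V n)" if "a \<in> \<Inter>?\<U>" "b \<in> \<Inter>?\<U>" for a b n
        by (rule closure_prod_subset[OF jointly_continuous prods[of _ n]]) (use that in auto)
      then show ?thesis
        unfolding subsemilattice_def by simp
    qed
    moreover have "y \<notin> \<Inter>?\<U>"
      using V0 V(3) by blast
    ultimately show "\<exists>\<U>. countable \<U> \<and> (\<forall>N\<in>\<U>. closed_neighborhood x N) \<and>
        subsemilattice f (\<Inter>\<U>) \<and> y \<notin> \<Inter>\<U>"
      by (intro exI[of _ ?\<U>] conjI) (simp_all del: Inter_iff)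
  qed
qed

end
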